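(* Let $m,n\ge 1$, let $A\in\mathbb{R}^{m\times n}$ have rows $a_1^T,\dots,a_m^T$ with $\|a_i\|^2=1$ for all $i$, let $b\in\mathbb{R}^m$, and let $\rho>0$. Consider the randomized penalty Kaczmarz (RPK) iteration with penalty parameter $\rho$ started at $x_0\in\mathbb{R}^n$. (LS) Suppose the linear system $Ax=b$ is consistent, and let $x^*=\arg\min_{Ax=b}\|x_0-x\|^2=x_0-A^{\dagger}(Ax_0-b)$. Then the sequence $(x_k)$ generated by the RPK iteration for the LS problem converges, in the sense that $\mathbb{E}[\|x_k-x^*\|^2]\to 0$ as $k\to\infty$, and for every $k\ge 0$ $$\mathbb{E}\left[\|x_{k+1}-x^*\|^2\right]\le\left(1-\frac{\rho(\rho+2)}{(1+\rho)^2}\,\frac{\lambda_{\min}(A^TA)}{m}\right)^{k+1}\mathbb{E}\left[\|x_0-x^*\|^2\right].$$ (LF) Suppose the feasible region $\mathcal{X}=\{x\in\mathbb{R}^n: Ax\le b\}$ is nonempty, and let $L>0$ be a Hoffman constant for it. Then the sequence $(x_k)$ generated by the RPK iteration for the LF problem converges, in the sense that $\mathbb{E}[d(x_k,\mathcal{X})^2]\to 0$ as $k\to\infty$, and for every $k\ge 0$ $$\mathbb{E}\left[d(x_{k+1},\mathcal{X})^2\right]\le\left(1-\frac{\rho(\rho+2)}{(1+\rho)^2}\,\frac{1}{mL^2}\right)^{k+1}\mathbb{E}\left[d(x_0,\mathcal{X})^2\right].$$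
   Context: Notation: $\|\cdot\|$ is the Euclidean norm; $t^+=\max\{t,0\}$, applied componentwise to vectors; $\lambda_{\min}(A^TA)$ is the smallest eigenvalue of $A^TA$; $A^\dagger$ is the Moore–Penrose pseudoinverse; vector inequalities are componentwise. Problems: LS asks for $x$ with $Ax=b$; LF asks for $x$ with $Ax\le b$. For LF, $d(x,\mathcal{X})=\min_{y\in\mathcal{X}}\|x-y\|=\|x-\mathcal{P}(x)\|$, where $\mathcal{P}$ is the Euclidean projection onto $\mathcal{X}$. Hoffman constant: a constant $L>0$ such that $d(x,\mathcal{X})^2\le L^2\|(Ax-b)^+\|^2$ for all $x\in\mathbb{R}^n$ (such a constant exists by Hoffman's theorem). RPK iteration with fixed penalty parameter $\rho>0$: choose an initial point $x_0\in\mathbb{R}^n$. For $k=0,1,2,\dots$, select an index $i\in\{1,\dots,m\}$ at random, independently of the previous choices, with probability $p_i=\|a_i\|^2/\|A\|_F^2$ (which equals $1/m$ since all rows have unit norm), and set $$x_{k+1}=x_k-\frac{r_k}{\frac1\rho+\|a_i\|^2}\,a_i,\qquad r_k=\begin{cases}a_i^Tx_k-b_i & \text{(LS)},\\ (a_i^Tx_k-b_i)^+ & \text{(LF)}.\end{cases}$$ $\mathbb{E}$ denotes expectation over all random index choices. *)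

theory Defs
  imports "HOL-Probability.Probability"
begin

definition eigenvalues :: "real^'n^'n \<Rightarrow> real set" where
  "eigenvalues B = {\<mu>. \<exists>v. v \<noteq> 0 \<and> B *v v = \<mu> *\<^sub>R v}"

text \<open>
  Meant for symmetric \<open>B\<close>, whose set of real eigenvalues is finite and nonempty.
\<close>

definition lambda_min :: "real^'n^'n \<Rightarrow> real" where
  "lambda_min B = Min (eigenvalues B)"

text \<open>The four Penrose conditions; they have exactly one solution \<open>X\<close> for every \<open>A\<close>.\<close>

definition is_pinv :: "real^'n^'m \<Rightarrow> real^'m^'n \<Rightarrow> bool" where
  "is_pinv A X \<longleftrightarrow>
     A ** X ** A = A \<and> X ** A ** X = X \<and>
     transpose (A ** X) = A ** X \<and> transpose (X ** A) = X ** A"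

definition pinv :: "real^'n^'m \<Rightarrow> real^'m^'n" where
  "pinv A = (THE X. is_pinv A X)"

definition pos_part :: "real^'m \<Rightarrow> real^'m" where
  "pos_part v = (\<chi> i. max (v $ i) 0)"

definition feasible_region :: "real^'n^'m \<Rightarrow> real^'m \<Rightarrow> (real^'n) set" where
  "feasible_region A b = {x. A *v x \<le> b}"

lemma closed_feasible_region: "closed (feasible_region A b)"
proof -
  have "feasible_region A b = (\<Inter>i. {x. row i A \<bullet> x \<le> b $ i})"
    by (auto simp: feasible_region_def less_eq_vec_def matrix_vector_mul_component row_def)
  then show ?thesis
    by (simp add: closed_INT closed_halfspace_le)
qed

text \<open>
  The distance to a nonempty feasible region is an attained minimum, namely the distance to the projection.
\<close>

lemma infdist_feasible_region:
  assumes "feasible_region A b \<noteq> {}"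
  shows "infdist x (feasible_region A b) = norm (x - closest_point (feasible_region A b) x)"
    and "closest_point (feasible_region A b) x \<in> feasible_region A b"
    and "y \<in> feasible_region A b \<Longrightarrow> infdist x (feasible_region A b) \<le> norm (x - y)"
proof -
  let ?X = "feasible_region A b"
  show p: "closest_point ?X x \<in> ?X"
    using assms by (rule closest_point_in_set[OF closed_feasible_region])
  have "infdist x ?X = dist x (closest_point ?X x)"
  proof (rule antisym)
    show "infdist x ?X \<le> dist x (closest_point ?X x)"
      using p by (rule infdist_le)
    show "dist x (closest_point ?X x) \<le> infdist x ?X"
      unfolding infdist_notempty[OF assms]
      by (rule cINF_greatest[OF assms]) (rule closest_point_le[OF closed_feasible_region])
  qed
  then show "infdist x ?X = norm (x - closest_point ?X x)"
    by (simp add: dist_norm)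
  show "infdist x ?X \<le> norm (x - y)" if "y \<in> ?X"
    using infdist_le[OF that] by (simp add: dist_norm)
qed

definition hoffman_constant :: "real^'n^'m \<Rightarrow> real^'m \<Rightarrow> real \<Rightarrow> bool" where
  "hoffman_constant A b L \<longleftrightarrow>
     L > 0 \<and> (\<forall>x. (infdist x (feasible_region A b))\<^sup>2 \<le> L\<^sup>2 * (norm (pos_part (A *v x - b)))\<^sup>2)"

text \<open>
  One run of the iteration along a fixed sequence \<open>s\<close> of selected rows. The function
  \<open>\<phi>\<close> turns the signed residual of the selected row into \<open>r\<^sub>k\<close>.
\<close>

primrec rpk :: "(real \<Rightarrow> real) \<Rightarrow> real \<Rightarrow> real^'n^'m \<Rightarrow> real^'m \<Rightarrow> real^'n \<Rightarrow> (nat \<Rightarrow> 'm) \<Rightarrow> nat \<Rightarrow> real^'n"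
  where
  "rpk \<phi> \<rho> A b x0 s 0 = x0"
| "rpk \<phi> \<rho> A b x0 s (Suc k) =
     (let x = rpk \<phi> \<rho> A b x0 s k; a = row (s k) A; r = \<phi> (a \<bullet> x - b $ s k)
      in x - (r / (1 / \<rho> + (norm a)\<^sup>2)) *\<^sub>R a)"

definition rpk_LS :: "real \<Rightarrow> real^'n^'m \<Rightarrow> real^'m \<Rightarrow> real^'n \<Rightarrow> (nat \<Rightarrow> 'm) \<Rightarrow> nat \<Rightarrow> real^'n" where
  "rpk_LS = rpk (\<lambda>t. t)"

definition rpk_LF :: "real \<Rightarrow> real^'n^'m \<Rightarrow> real^'m \<Rightarrow> real^'n \<Rightarrow> (nat \<Rightarrow> 'm) \<Rightarrow> nat \<Rightarrow> real^'n" where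
  "rpk_LF = rpk (\<lambda>t. max t 0)"

text \<open>
  \<open>idx k \<omega>\<close> is the row selected in step \<open>k\<close>. On \<open>real^'n^'m\<close> the library norm is the
  Frobenius norm, so \<open>norm A\<close> below is the Frobenius norm of \<open>A\<close>.
\<close>

definition random_row_selection :: "real^'n^'m \<Rightarrow> 'w measure \<Rightarrow> (nat \<Rightarrow> 'w \<Rightarrow> 'm) \<Rightarrow> bool" where
  "random_row_selection A M idx \<longleftrightarrow>
     prob_space M \<and>
     prob_space.indep_vars M (\<lambda>_. count_space UNIV) idx UNIV \<and>
     (\<forall>k i. measure M {\<omega> \<in> space M. idx k \<omega> = i} = (norm (row i A))\<^sup>2 / (norm A)\<^sup>2)"

lemma norm_matrix_frobenius:
  fixes A :: "real^'n^'m"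
  shows "(norm A)\<^sup>2 = (\<Sum>i\<in>UNIV. \<Sum>j\<in>UNIV. (A $ i $ j)\<^sup>2)"
  by (simp add: norm_vec_def L2_set_def real_sqrt_pow2 sum_nonneg)

end

theory Submission
  imports Defs
begin

text \<open>
  Both halves rest on one computation. For a point \<open>p\<close> that satisfies the selected constraint,
  write \<open>e = x - p\<close>. A step moves \<open>x\<close> along the unit row \<open>a\<close> by \<open>c * r\<close> with
  \<open>c = \<rho> / (1 + \<rho>)\<close>. Since \<open>r * (a \<bullet> e) \<ge> r\<^sup>2\<close> for the signed residual as well as
  for its positive part, the squared distance to \<open>p\<close> drops by at least
  \<open>\<gamma> * r\<^sup>2\<close>, where \<open>\<gamma> = 2 * c - c\<^sup>2 = \<rho> * (\<rho> + 2) / (1 + \<rho>)\<^sup>2\<close>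
  (\<open>damped_step_decrease\<close>). Averaging over the \<open>m\<close> equally likely rows turns \<open>r\<^sup>2\<close> into \<open>1 / m\<close>
  times the squared norm of the full residual, and an error bound \<open>\<sigma> * f x \<le> (norm (r x))\<^sup>2\<close>
  turns that into a contraction by the factor \<open>1 - \<gamma> * \<sigma> / m\<close>
  (\<open>rpk_expected_contraction\<close>). The row used in step \<open>k\<close> is independent of the first \<open>k\<close>
  choices, which determine \<open>x\<^sub>k\<close>, so the contraction survives the expectation
  (\<open>expected_contraction\<close>).

  For inequalities \<open>p\<close> is the projection of the current iterate and the error bound is Hoffman's,
  with \<open>\<sigma> = 1 / L\<^sup>2\<close>. For equations \<open>p\<close> is the solution nearest to \<open>x0\<close>, and the
  smallest eigenvalue of the Gram matrix serves as \<open>\<sigma>\<close> (\<open>lambda_min_gram_le\<close>). That eigenvalue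
  vanishes when the columns of \<open>A\<close> are dependent, and the rate then says nothing about convergence.
  Convergence holds all the same because every step changes the error by a multiple of a row:
  the error never leaves the orthogonal complement of the null space, and on this subspace \<open>A\<close> is
  injective, hence bounded below by some positive \<open>\<sigma>\<close> (\<open>null_complement_bounded_below\<close>).
  The same subspace identifies the limit: \<open>x0 - pinv A *v (A *v x0 - b)\<close> is a solution
  whose difference from \<open>x0\<close> is orthogonal to the null space, so by Pythagoras it is the nearest one.
\<close>

section \<open>Nonnegative sequences with geometric decrease\<close>

text \<open>
  A negative factor \<open>q\<close> forces a nonnegative sequence to vanish, so the bounds hold for it as well.
  This saves bounding the rates of the two iterations from below, which would need estimates for
  the smallest eigenvalue and for the Hoffman constant.
\<close>

lemma geometric_decay:
  fixes u :: "nat \<Rightarrow> real"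
  assumes nonneg: "\<And>k. u k \<ge> 0" and step: "\<And>k. u (Suc k) \<le> q * u k"
  shows "u k \<le> q ^ k * u 0" and "q < 1 \<Longrightarrow> u \<longlonglongrightarrow> 0"
proof -
  have vanish: "u j = 0" if "q < 0" for j
  proof -
    have "0 \<le> q * u j"
      using nonneg[of "Suc j"] step[of j] by linarith
    then show ?thesis
      using that nonneg[of j] by (simp add: zero_le_mult_iff)
  qed
  have bound: "u k \<le> q ^ k * u 0" for k
  proof (cases "q < 0")
    case True
    then show ?thesis by (simp add: vanish)
  next
    case False
    show ?thesis
    proof (induction k)
      case (Suc k)
      have "u (Suc k) \<le> q * u k" by (rule step)
      also have "\<dots> \<le> q * (q ^ k * u 0)"
        using Suc False by (intro mult_left_mono) auto
      finally show ?case by (simp add: mult.assoc)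
    qed simp
  qed
  then show "u k \<le> q ^ k * u 0" .
  show "u \<longlonglongrightarrow> 0" if "q < 1"
  proof (cases "q < 0")
    case True
    then have "u = (\<lambda>_. 0)" using vanish by auto
    then show ?thesis by simp
  next
    case False
    then have "(\<lambda>k. q ^ k * u 0) \<longlonglongrightarrow> 0"
      using that by (intro tendsto_mult_left_zero LIMSEQ_realpow_zero) auto
    then show ?thesis
      by (rule tendsto_sandwich[OF _ _ tendsto_const, rotated -1])
         (use nonneg bound in auto)
  qed
qed

section \<open>Expectation along independent finite-valued choices\<close>

text \<open>
  Conditioning on the past, in elementary form. The first \<open>k\<close> choices take finitely many values,
  so every function of them is measurable and bounded; splitting the integrand according to the
  value of the choice in step \<open>k\<close> leaves products of independent factors.
\<close>

lemma (in prob_space) expectation_past_and_present: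
  fixes idx :: "nat \<Rightarrow> 'a \<Rightarrow> 'i::finite" and G :: "(nat \<Rightarrow> 'i) \<Rightarrow> 'i \<Rightarrow> real"
  assumes indep: "indep_vars (\<lambda>_. count_space UNIV) idx UNIV"
    and past: "\<And>s t i. (\<And>j. j < k \<Longrightarrow> s j = t j) \<Longrightarrow> G s i = G t i"
  shows "integrable M (\<lambda>\<omega>. G (\<lambda>j. idx j \<omega>) i)"
    and "expectation (\<lambda>\<omega>. G (\<lambda>j. idx j \<omega>) (idx k \<omega>)) =
      (\<Sum>i\<in>UNIV. prob {\<omega> \<in> space M. idx k \<omega> = i} * expectation (\<lambda>\<omega>. G (\<lambda>j. idx j \<omega>) i))"
proof -
  define hist where "hist \<omega> = restrict (\<lambda>j. idx j \<omega>) {..<k}" for \<omega>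
  let ?H = "PiM {..<k} (\<lambda>_. count_space (UNIV :: 'i set))"
  have H: "?H = count_space ({..<k} \<rightarrow>\<^sub>E UNIV)"
    by (rule count_space_PiM_finite) auto
  have G_hist: "G (\<lambda>j. idx j \<omega>) i = G (hist \<omega>) i" for \<omega> i
    by (rule past) (simp add: hist_def)
  have rv: "idx j \<in> measurable M (count_space UNIV)" for j
    using indep by (simp add: indep_vars_def)
  have meas_hist: "hist \<in> measurable M ?H"
    unfolding hist_def by (intro measurable_restrict rv)
  have meas_G: "(\<lambda>s. G s i) \<in> borel_measurable ?H" for i
    unfolding H by simp
  have meas_GM: "(\<lambda>\<omega>. G (hist \<omega>) i) \<in> borel_measurable M" for i
    by (rule measurable_compose[OF meas_hist meas_G])
  have finite_hist: "finite ({..<k} \<rightarrow>\<^sub>E (UNIV :: 'i set))"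
    by (intro finite_PiE) auto
  have hist_range: "hist \<omega> \<in> {..<k} \<rightarrow>\<^sub>E UNIV" for \<omega>
    by (auto simp: hist_def)
  have int_G: "integrable M (\<lambda>\<omega>. G (hist \<omega>) i)" for i
  proof (rule integrable_const_bound[OF _ meas_GM])
    show "AE \<omega> in M. norm (G (hist \<omega>) i) \<le> Max ((\<lambda>s. norm (G s i)) ` ({..<k} \<rightarrow>\<^sub>E UNIV))"
      using finite_hist hist_range by (intro AE_I2 Max_ge) auto
  qed
  then show "integrable M (\<lambda>\<omega>. G (\<lambda>j. idx j \<omega>) i)"
    by (simp add: G_hist)
  have meas_ind: "(\<lambda>\<omega>. indicator {i} (idx k \<omega>) :: real) \<in> borel_measurable M" for i
    by (rule measurable_compose[OF rv]) simp
  have int_ind: "integrable M (\<lambda>\<omega>. indicator {i} (idx k \<omega>) :: real)" for i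
    by (rule integrable_const_bound[where B = 1, OF _ meas_ind]) (auto simp: indicator_def)
  have E_ind: "expectation (\<lambda>\<omega>. indicator {i} (idx k \<omega>)) = prob {\<omega> \<in> space M. idx k \<omega> = i}" for i
  proof -
    have "expectation (\<lambda>\<omega>. indicator {i} (idx k \<omega>)) =
        expectation (indicator {\<omega> \<in> space M. idx k \<omega> = i})"
      by (rule Bochner_Integration.integral_cong) (auto simp: indicator_def)
    also have "\<dots> = prob {\<omega> \<in> space M. idx k \<omega> = i}"
      by (simp add: Int_def conj_commute cong: conj_cong)
    finally show ?thesis .
  qed
  have indep_GI: "indep_var borel (\<lambda>\<omega>. indicator {i} (idx k \<omega>) :: real) borel (\<lambda>\<omega>. G (hist \<omega>) i)"
    for i
  proof -
    have "indep_var (PiM {k} (\<lambda>_. count_space UNIV)) (\<lambda>\<omega>. restrict (\<lambda>j. idx j \<omega>) {k})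
        ?H (\<lambda>\<omega>. restrict (\<lambda>j. idx j \<omega>) {..<k})"
      by (rule indep_var_restrict[OF indep]) auto
    then have "indep_var borel ((\<lambda>s. indicator {i} (s k) :: real) \<circ> (\<lambda>\<omega>. restrict (\<lambda>j. idx j \<omega>) {k}))
        borel ((\<lambda>s. G s i) \<circ> (\<lambda>\<omega>. restrict (\<lambda>j. idx j \<omega>) {..<k}))"
    proof (rule indep_var_compose)
      show "(\<lambda>s. indicator {i} (s k) :: real) \<in> borel_measurable (PiM {k} (\<lambda>_. count_space UNIV))"
        by (rule measurable_compose[OF measurable_component_singleton[where i = k]]) auto
    qed (rule meas_G)
    then show ?thesis
      by (simp add: o_def hist_def)
  qed
  have "expectation (\<lambda>\<omega>. G (\<lambda>j. idx j \<omega>) (idx k \<omega>)) =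
      expectation (\<lambda>\<omega>. \<Sum>i\<in>UNIV. indicator {i} (idx k \<omega>) * G (hist \<omega>) i)"
    by (simp add: G_hist indicator_def)
  also have "\<dots> = (\<Sum>i\<in>UNIV. expectation (\<lambda>\<omega>. indicator {i} (idx k \<omega>) * G (hist \<omega>) i))"
    by (intro Bochner_Integration.integral_sum indep_var_integrable[OF indep_GI] int_ind int_G)
  also have "\<dots> = (\<Sum>i\<in>UNIV. prob {\<omega> \<in> space M. idx k \<omega> = i} * expectation (\<lambda>\<omega>. G (hist \<omega>) i))"
    by (intro sum.cong refl)
       (simp add: indep_var_lebesgue_integral[OF indep_GI int_ind int_G] E_ind)
  finally show "expectation (\<lambda>\<omega>. G (\<lambda>j. idx j \<omega>) (idx k \<omega>)) =
      (\<Sum>i\<in>UNIV. prob {\<omega> \<in> space M. idx k \<omega> = i} * expectation (\<lambda>\<omega>. G (\<lambda>j. idx j \<omega>) i))"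
    by (simp add: G_hist)
qed

text \<open>
  The invariant \<open>I\<close> lets the one-step contraction be required only on states that can occur.
  For equations this is essential: the contraction that gives convergence holds only on a subspace
  when the null space of the matrix is not trivial.
\<close>

lemma (in prob_space) expected_contraction:
  fixes idx :: "nat \<Rightarrow> 'a \<Rightarrow> 'i::finite" and X :: "(nat \<Rightarrow> 'i) \<Rightarrow> nat \<Rightarrow> 's"
    and f :: "'s \<Rightarrow> real"
  assumes indep: "indep_vars (\<lambda>_. count_space UNIV) idx UNIV"
    and start: "\<And>s. X s 0 = x0" and step: "\<And>s k. X s (Suc k) = T (s k) (X s k)"
    and inv_start: "I x0" and inv_step: "\<And>i x. I x \<Longrightarrow> I (T i x)"
    and contract: "\<And>k x. I x \<Longrightarrow>
      (\<Sum>i\<in>UNIV. prob {\<omega> \<in> space M. idx k \<omega> = i} * f (T i x)) \<le> q * f x"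
  shows "expectation (\<lambda>\<omega>. f (X (\<lambda>j. idx j \<omega>) (Suc k))) \<le> q * expectation (\<lambda>\<omega>. f (X (\<lambda>j. idx j \<omega>) k))"
proof -
  \<comment> \<open>The state before step \<open>k\<close> is a function of the choices made before step \<open>k\<close>.\<close>
  have past: "X s k = X t k" if "\<And>j. j < k \<Longrightarrow> s j = t j" for s t k
    using that by (induction k) (auto simp: start step)
  have inv: "I (X s k)" for s k
    by (induction k) (auto simp: start step inv_start inv_step)
  have past_T: "f (T i (X s k)) = f (T i (X t k))" if "\<And>j. j < k \<Longrightarrow> s j = t j" for s t i
    using past[OF that] by simp
  have past_f: "f (X s k) = f (X t k)" if "\<And>j. j < k \<Longrightarrow> s j = t j" for s t
    using past[OF that] by simp
  note split = expectation_past_and_present[OF indep, where k = k and G = "\<lambda>s i. f (T i (X s k))", OF past_T]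
  have int_f: "integrable M (\<lambda>\<omega>. f (X (\<lambda>j. idx j \<omega>) k))"
    by (rule expectation_past_and_present(1)[OF indep, where k = k and G = "\<lambda>s _. f (X s k)", OF past_f])
  have "expectation (\<lambda>\<omega>. f (X (\<lambda>j. idx j \<omega>) (Suc k))) =
      expectation (\<lambda>\<omega>. f (T (idx k \<omega>) (X (\<lambda>j. idx j \<omega>) k)))"
    by (simp add: step)
  also have "\<dots> = (\<Sum>i\<in>UNIV. prob {\<omega> \<in> space M. idx k \<omega> = i} *
      expectation (\<lambda>\<omega>. f (T i (X (\<lambda>j. idx j \<omega>) k))))"
    by (rule split(2))
  also have "\<dots> = expectation (\<lambda>\<omega>. \<Sum>i\<in>UNIV. prob {\<omega> \<in> space M. idx k \<omega> = i} *
      f (T i (X (\<lambda>j. idx j \<omega>) k)))"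
    using split(1) by simp
  also have "\<dots> \<le> expectation (\<lambda>\<omega>. q * f (X (\<lambda>j. idx j \<omega>) k))"
    using split(1) int_f by (intro integral_mono contract inv Bochner_Integration.integrable_sum) auto
  finally show ?thesis by simp
qed

section \<open>The Moore-Penrose inverse and the nearest solution\<close>

lemma inner_transpose_matrix:
  fixes A :: "real^'n^'m"
  shows "x \<bullet> (A *v y) = (transpose A *v x) \<bullet> y"
  using dot_lmul_matrix[of x A y] vector_transpose_matrix[of x "transpose A"] by simp

lemma inner_inverse_exists:
  fixes C :: "real^'n^'m"
  shows "\<exists>G. C ** G ** C = C"
proof -
  obtain g where g: "linear g" "\<And>x. C *v g (C *v x) = C *v x"
    using linear_exists_right_inverse_on[of "(*v) C" UNIV] by auto
  have "(C ** matrix g ** C) *v x = C *v x" for x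
    using g by (simp add: matrix_works flip: matrix_vector_mul_assoc)
  then show ?thesis
    by (metis matrix_eq)
qed

text \<open>
  The range of \<open>A\<close> meets the null space of \<open>transpose A\<close> only in \<open>0\<close>, because a vector in both is
  orthogonal to itself.
\<close>

lemma gram_left_cancel:
  fixes A :: "real^'n^'m" and B C :: "real^'k^'n"
  assumes "transpose A ** A ** B = transpose A ** A ** C"
  shows "A ** B = A ** C"
proof -
  have "A *v (B *v x) = A *v (C *v x)" for x
  proof -
    define w where "w = A *v (B *v x - C *v x)"
    have "transpose A *v w = (transpose A ** A ** B) *v x - (transpose A ** A ** C) *v x"
      by (simp add: w_def matrix_vector_mult_diff_distrib matrix_vector_mul_assoc matrix_mul_assoc)
    then have "transpose A *v w = 0" by (simp add: assms)
    then have "w \<bullet> w = 0"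
      by (subst (2) w_def) (simp add: inner_transpose_matrix)
    then show ?thesis
      by (simp add: w_def matrix_vector_mult_diff_distrib)
  qed
  then show ?thesis
    by (simp add: matrix_eq flip: matrix_vector_mul_assoc)
qed

text \<open>
  For any inner inverse \<open>G\<close> of the Gram matrix, \<open>P = A ** G ** transpose A\<close> is the orthogonal
  projection onto the range of \<open>A\<close>. It fixes the range by cancellation, and
  \<open>P ** transpose P = P\<close> then yields its symmetry even though \<open>G\<close> need not be symmetric.
\<close>

lemma least_squares_inverse_exists:
  fixes A :: "real^'n^'m"
  shows "\<exists>Z. A ** Z ** A = A \<and> transpose (A ** Z) = A ** Z"
proof -
  obtain G where G: "(transpose A ** A) ** G ** (transpose A ** A) = transpose A ** A"
    using inner_inverse_exists by blast
  define P where "P = A ** G ** transpose A"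
  have PA: "P ** A = A"
    using gram_left_cancel[of A "G ** transpose A ** A" "mat 1"] G
    by (simp add: P_def matrix_mul_assoc)
  then have "transpose A ** transpose P = transpose A"
    by (metis matrix_transpose_mul)
  then have "P ** transpose P = P"
    unfolding P_def by (metis matrix_mul_assoc)
  then have "transpose P = P"
    by (metis matrix_transpose_mul transpose_transpose)
  then show ?thesis
    using PA by (intro exI[of _ "G ** transpose A"]) (simp add: P_def matrix_mul_assoc)
qed

text \<open>
  One inverse \<open>Z\<close> makes \<open>A ** Z\<close> symmetric, and applying the previous lemma to the transpose
  gives another, \<open>Y\<close>, for which \<open>Y ** A\<close> is symmetric. The product \<open>Y ** A ** Z\<close> inherits
  both properties.
\<close>

lemma is_pinv_exists: "\<exists>X. is_pinv A X"
proof -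
  obtain Z where Z: "A ** Z ** A = A" "transpose (A ** Z) = A ** Z"
    using least_squares_inverse_exists by blast
  obtain W where W: "transpose A ** W ** transpose A = transpose A"
      "transpose (transpose A ** W) = transpose A ** W"
    using least_squares_inverse_exists by blast
  define Y where "Y = transpose W"
  have AYA: "A ** Y ** A = A"
    using arg_cong[OF W(1), of transpose] by (simp add: Y_def matrix_transpose_mul matrix_mul_assoc)
  have YA: "transpose (Y ** A) = Y ** A"
    using W(2) by (simp add: Y_def matrix_transpose_mul)
  define X where "X = Y ** A ** Z"
  have AX: "A ** X = A ** Z"
    using AYA by (simp add: X_def matrix_mul_assoc)
  have XA: "X ** A = Y ** A"
    using Z(1) by (metis X_def matrix_mul_assoc)
  have "X ** A ** X = X"
    using AYA by (metis XA X_def matrix_mul_assoc)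
  then have "is_pinv A X"
    unfolding is_pinv_def using AX XA Z YA by simp
  then show ?thesis ..
qed

text \<open>
  Two Penrose inverses have \<open>A ** X = A ** Y\<close>: both are symmetric idempotents with the range
  of \<open>A\<close>. Dually \<open>X ** A = Y ** A\<close>, and \<open>X ** A ** X\<close> depends on \<open>X\<close> only through these products.
\<close>

lemma is_pinv_unique:
  assumes X: "is_pinv A X" and Y: "is_pinv A Y"
  shows "X = Y"
proof -
  note X' = X[unfolded is_pinv_def] and Y' = Y[unfolded is_pinv_def]
  have "A ** X = (A ** Y) ** (A ** X)"
    using Y' by (simp add: matrix_mul_assoc)
  also have "\<dots> = transpose ((A ** X) ** (A ** Y))"
    using X' Y' by (simp add: matrix_transpose_mul[of "A ** X" "A ** Y"])
  also have "(A ** X) ** (A ** Y) = A ** Y"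
    using X' by (simp add: matrix_mul_assoc)
  finally have AX: "A ** X = A ** Y" using Y' by simp
  have "X ** A = (X ** A) ** (Y ** A)"
    using Y' by (metis matrix_mul_assoc)
  also have "\<dots> = transpose ((Y ** A) ** (X ** A))"
    using X' Y' by (simp add: matrix_transpose_mul[of "Y ** A" "X ** A"])
  also have "(Y ** A) ** (X ** A) = Y ** A"
    using X' by (metis matrix_mul_assoc)
  finally have XA: "X ** A = Y ** A" using Y' by simp
  have "X = X ** A ** X" using X' by simp
  also have "\<dots> = Y ** A ** Y" using AX XA by (metis matrix_mul_assoc)
  finally show ?thesis using Y' by simp
qed

lemma is_pinv_pinv: "is_pinv A (pinv A)"
  unfolding pinv_def using is_pinv_exists is_pinv_unique by (metis theI)

text \<open>
  This is the row space of \<open>A\<close>; orthogonality to the null space is the form in which it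
  enters every argument below.
\<close>

definition null_complement :: "real^'n^'m \<Rightarrow> (real^'n) set" where
  "null_complement A = {e. \<forall>h. A *v h = 0 \<longrightarrow> e \<bullet> h = 0}"

lemma subspace_null_complement: "subspace (null_complement A)"
  by (auto simp: subspace_def null_complement_def inner_add_left)

lemma row_inner: "row i A \<bullet> x = (A *v x) $ i"
  by (simp add: row_def matrix_vector_mul_component)

lemma row_in_null_complement: "row i A \<in> null_complement A"
  by (simp add: null_complement_def row_inner)

lemma null_complement_bounded_below:
  fixes A :: "real^'n^'m"
  obtains \<sigma> where "\<sigma> > 0" "\<And>e. e \<in> null_complement A \<Longrightarrow> \<sigma> * (norm e)\<^sup>2 \<le> (norm (A *v e))\<^sup>2"
proof -
  have "\<exists>c>0. \<forall>e\<in>null_complement A. norm (A *v e) \<ge> c * norm e"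
  proof (rule injective_imp_isometric)
    show "\<forall>e\<in>null_complement A. A *v e = 0 \<longrightarrow> e = 0"
      by (auto simp: null_complement_def dest: spec[where x = "_ :: real^'n"])
  qed (auto simp: subspace_null_complement closed_subspace matrix_vector_mul_bounded_linear)
  then obtain c where c: "c > 0" "\<And>e. e \<in> null_complement A \<Longrightarrow> c * norm e \<le> norm (A *v e)"
    by auto
  have "c\<^sup>2 * (norm e)\<^sup>2 \<le> (norm (A *v e))\<^sup>2" if "e \<in> null_complement A" for e
    using power_mono[OF c(2)[OF that], of 2] c(1) by (simp add: power_mult_distrib)
  then show ?thesis
    using that[of "c\<^sup>2"] c(1) by simp
qed

text \<open>
  The correction \<open>x0 - y\<close> lies in the range of \<open>pinv A ** A\<close>, a symmetric matrix that annihilates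
  the null space of \<open>A\<close>.
\<close>

lemma pinv_correction:
  fixes A :: "real^'n^'m" and x0 :: "real^'n"
  assumes "A *v z = b"
  defines "y \<equiv> x0 - pinv A *v (A *v x0 - b)"
  shows "A *v y = b" and "x0 - y \<in> null_complement A"
proof -
  note P = is_pinv_pinv[of A, unfolded is_pinv_def]
  have d: "x0 - y = (pinv A ** A) *v (x0 - z)"
    by (simp add: y_def assms(1)[symmetric] matrix_vector_mult_diff_distrib matrix_vector_mul_assoc)
  have "A *v (x0 - y) = A *v (x0 - z)"
    using P by (simp add: d matrix_vector_mul_assoc matrix_mul_assoc)
  then show "A *v y = b"
    using assms(1) by (simp add: matrix_vector_mult_diff_distrib)
  have "(x0 - y) \<bullet> h = 0" if "A *v h = 0" for h
  proof -
    have "(x0 - y) \<bullet> h = (x0 - z) \<bullet> ((pinv A ** A) *v h)"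
      using P by (simp add: d inner_transpose_matrix)
    then show ?thesis
      using that by (simp flip: matrix_vector_mul_assoc)
  qed
  then show "x0 - y \<in> null_complement A"
    by (simp add: null_complement_def)
qed

lemma is_arg_min_nearest_solution_iff:
  fixes A :: "real^'n^'m"
  assumes y: "A *v y = b" "x0 - y \<in> null_complement A"
  shows "is_arg_min (\<lambda>x. (norm (x0 - x))\<^sup>2) (\<lambda>x. A *v x = b) xs \<longleftrightarrow> xs = y"
proof -
  have pyth: "(norm (x0 - x))\<^sup>2 = (norm (x0 - y))\<^sup>2 + (norm (y - x))\<^sup>2" if "A *v x = b" for x
  proof -
    have "(x0 - y) \<bullet> (y - x) = 0"
      using y that by (simp add: null_complement_def matrix_vector_mult_diff_distrib)
    then have "(norm ((x0 - y) + (y - x)))\<^sup>2 = (norm (x0 - y))\<^sup>2 + (norm (y - x))\<^sup>2"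
      by (intro norm_add_Pythagorean) (simp add: orthogonal_def)
    then show ?thesis by simp
  qed
  show ?thesis
  proof
    assume xs: "is_arg_min (\<lambda>x. (norm (x0 - x))\<^sup>2) (\<lambda>x. A *v x = b) xs"
    then have "A *v xs = b" "(norm (x0 - xs))\<^sup>2 \<le> (norm (x0 - y))\<^sup>2"
      using y(1) by (auto simp: is_arg_min_def not_less)
    with pyth[of xs] have "(norm (y - xs))\<^sup>2 \<le> 0" by linarith
    then show "xs = y" by simp
  next
    assume "xs = y"
    moreover have "(norm (x0 - y))\<^sup>2 \<le> (norm (x0 - x))\<^sup>2" if "A *v x = b" for x
      unfolding pyth[OF that] by simp
    ultimately show "is_arg_min (\<lambda>x. (norm (x0 - x))\<^sup>2) (\<lambda>x. A *v x = b) xs"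
      using y(1) by (auto simp: is_arg_min_def not_less)
  qed
qed

section \<open>The smallest eigenvalue of the Gram matrix\<close>

text \<open>
  Eigenvectors for distinct eigenvalues are orthogonal, so there are at most as many eigenvalues as
  dimensions. Finiteness is what gives the minimum defining \<open>lambda_min\<close> its meaning.
\<close>

lemma finite_eigenvalues_symmetric:
  fixes B :: "real^'n^'n"
  assumes sym: "transpose B = B"
  shows "finite (eigenvalues B)"
proof -
  have "\<exists>v. \<forall>\<mu>\<in>eigenvalues B. v \<mu> \<noteq> 0 \<and> B *v v \<mu> = \<mu> *\<^sub>R v \<mu>"
    by (rule bchoice) (simp add: eigenvalues_def)
  then obtain v where v: "\<And>\<mu>. \<mu> \<in> eigenvalues B \<Longrightarrow> v \<mu> \<noteq> 0 \<and> B *v v \<mu> = \<mu> *\<^sub>R v \<mu>"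
    by blast
  have orth: "v \<mu> \<bullet> v \<nu> = 0" if "\<mu> \<in> eigenvalues B" "\<nu> \<in> eigenvalues B" "\<mu> \<noteq> \<nu>" for \<mu> \<nu>
  proof -
    have "\<nu> * (v \<mu> \<bullet> v \<nu>) = v \<mu> \<bullet> (B *v v \<nu>)"
      using v that by simp
    also have "\<dots> = (B *v v \<mu>) \<bullet> v \<nu>"
      by (simp add: inner_transpose_matrix sym)
    also have "\<dots> = \<mu> * (v \<mu> \<bullet> v \<nu>)"
      using v that by simp
    finally show ?thesis using that(3) by simp
  qed
  have "independent (v ` eigenvalues B)"
    using v orth
    by (intro pairwise_orthogonal_independent) (auto simp: pairwise_def orthogonal_def)
  then have "finite (v ` eigenvalues B)"
    by (rule independent_imp_finite)
  moreover have "inj_on v (eigenvalues B)"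
    using v orth by (intro inj_onI) (metis inner_eq_zero_iff)
  ultimately show ?thesis
    by (rule finite_imageD)
qed

text \<open>
  The Rayleigh quotient attains its minimum \<open>\<mu>\<close> over the unit sphere, and a minimiser is an
  eigenvector for \<open>\<mu>\<close>. Hence \<open>\<mu>\<close> is an eigenvalue, and the smallest eigenvalue is at most
  \<open>\<mu>\<close>.
\<close>

lemma lambda_min_gram_le:
  fixes A :: "real^'n^'m"
  shows "lambda_min (transpose A ** A) * (norm e)\<^sup>2 \<le> (norm (A *v e))\<^sup>2"
proof -
  let ?B = "transpose A ** A"
  have "compact (sphere (0 :: real^'n) 1)" "sphere (0 :: real^'n) 1 \<noteq> {}"
    by auto
  moreover have "continuous_on (sphere 0 1) (\<lambda>x. (norm (A *v x))\<^sup>2)"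
    by (intro continuous_intros linear_continuous_on matrix_vector_mul_bounded_linear)
  ultimately obtain v where v: "norm v = 1"
    and min: "\<And>x. norm x = 1 \<Longrightarrow> (norm (A *v v))\<^sup>2 \<le> (norm (A *v x))\<^sup>2"
    using continuous_attains_inf[of "sphere (0 :: real^'n) 1" "\<lambda>x. (norm (A *v x))\<^sup>2"] by auto
  define \<mu> where "\<mu> = (norm (A *v v))\<^sup>2"
  have rayleigh: "\<mu> * (norm x)\<^sup>2 \<le> (norm (A *v x))\<^sup>2" for x
  proof (cases "x = 0")
    case False
    have "\<mu> \<le> (norm (A *v ((1 / norm x) *\<^sub>R x)))\<^sup>2"
      unfolding \<mu>_def using False by (intro min) simp
    also have "\<dots> = (norm (A *v x))\<^sup>2 / (norm x)\<^sup>2"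
      by (simp add: matrix_vector_mult_scaleR power_divide)
    finally show ?thesis
      using False by (simp add: field_simps)
  qed simp
  define w where "w = ?B *v v - \<mu> *\<^sub>R v"
  \<comment> \<open>The Rayleigh bound at \<open>v + t *\<^sub>R w\<close>, in powers of \<open>t\<close>: the constant terms cancel.\<close>
  have expand: "0 \<le> 2 * t * (w \<bullet> w) + t\<^sup>2 * ((norm (A *v w))\<^sup>2 - \<mu> * (norm w)\<^sup>2)" for t
  proof -
    have "(A *v v) \<bullet> (A *v w) - \<mu> * (v \<bullet> w) = w \<bullet> w"
      by (simp add: inner_transpose_matrix w_def matrix_vector_mul_assoc inner_diff_left)
    moreover have "(norm (A *v (v + t *\<^sub>R w)))\<^sup>2 =
        \<mu> + 2 * t * ((A *v v) \<bullet> (A *v w)) + t\<^sup>2 * (norm (A *v w))\<^sup>2"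
      unfolding \<mu>_def power2_norm_eq_inner
      by (simp add: matrix_vector_right_distrib matrix_vector_mult_scaleR inner_add_left inner_add_right
          inner_commute power2_eq_square algebra_simps)
    moreover have "(norm (v + t *\<^sub>R w))\<^sup>2 = 1 + 2 * t * (v \<bullet> w) + t\<^sup>2 * (norm w)\<^sup>2"
      using v unfolding norm_eq_1 power2_norm_eq_inner
      by (simp add: inner_add_left inner_add_right inner_commute power2_eq_square algebra_simps)
    ultimately show ?thesis
      using rayleigh[of "v + t *\<^sub>R w"] by (simp add: algebra_simps)
  qed
  have "w = 0"
  proof (rule ccontr)
    assume "w \<noteq> 0"
    then have pos: "w \<bullet> w > 0" by simp
    define K where "K = (norm (A *v w))\<^sup>2 - \<mu> * (norm w)\<^sup>2"
    have K: "K \<ge> 0" using rayleigh[of w] by (simp add: K_def)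
    \<comment> \<open>A minimiser of the quadratic would need division by \<open>K\<close>, which may be \<open>0\<close>;
      \<open>K + 1\<close> is safe and still makes the quadratic negative.\<close>
    define t where "t = - (w \<bullet> w) / (K + 1)"
    have "2 * t * (w \<bullet> w) + t\<^sup>2 * K = - ((w \<bullet> w)\<^sup>2 * (K + 2) / (K + 1)\<^sup>2)"
      using K by (simp add: t_def power2_eq_square divide_simps) (simp add: algebra_simps)
    also have "\<dots> < 0"
      using K pos by simp
    finally show False
      using expand[of t] by (simp add: K_def)
  qed
  then have "\<mu> \<in> eigenvalues ?B"
    using v by (auto simp: eigenvalues_def w_def intro!: exI[of _ v])
  then have "lambda_min ?B \<le> \<mu>"
    unfolding lambda_min_def
    by (intro Min_le finite_eigenvalues_symmetric) (simp_all add: matrix_transpose_mul)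
  then have "lambda_min ?B * (norm e)\<^sup>2 \<le> \<mu> * (norm e)\<^sup>2"
    by (intro mult_right_mono) auto
  with rayleigh[of e] show ?thesis by linarith
qed

section \<open>Decrease in one step\<close>

text \<open>
  The hypothesis on \<open>r\<close> covers both iterations: it is an equality for the residual \<open>a \<bullet> e\<close> of
  an equation, and for the positive part of an inequality's residual it says that a feasible point
  lies at least \<open>r\<close> behind the current point in the direction of the row, whenever \<open>r > 0\<close>.
\<close>

lemma damped_step_decrease:
  fixes a e :: "'a::real_inner"
  assumes unit: "(norm a)\<^sup>2 = 1" and \<rho>: "\<rho> > 0" and r: "r\<^sup>2 \<le> r * (a \<bullet> e)"
  shows "(norm (e - (r / (1 / \<rho> + (norm a)\<^sup>2)) *\<^sub>R a))\<^sup>2 \<le>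
    (norm e)\<^sup>2 - \<rho> * (\<rho> + 2) / (1 + \<rho>)\<^sup>2 * r\<^sup>2"
proof -
  define c where "c = \<rho> / (1 + \<rho>)"
  have "(2 * c - c\<^sup>2) * (1 + \<rho>)\<^sup>2 = 2 * (c * (1 + \<rho>)) * (1 + \<rho>) - (c * (1 + \<rho>))\<^sup>2"
    by (simp add: power2_eq_square algebra_simps)
  also have "c * (1 + \<rho>) = \<rho>"
    using \<rho> by (simp add: c_def)
  also have "2 * \<rho> * (1 + \<rho>) - \<rho>\<^sup>2 = \<rho> * (\<rho> + 2)"
    by (simp add: power2_eq_square algebra_simps)
  finally have "\<rho> * (\<rho> + 2) / (1 + \<rho>)\<^sup>2 = 2 * c - c\<^sup>2"
    using \<rho> by (simp add: divide_eq_eq)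
  moreover have "r / (1 / \<rho> + (norm a)\<^sup>2) = c * r" "c \<ge> 0"
    unfolding c_def unit using \<rho> by (auto simp: field_simps)
  ultimately have c: "r / (1 / \<rho> + (norm a)\<^sup>2) = c * r" "c \<ge> 0"
      "\<rho> * (\<rho> + 2) / (1 + \<rho>)\<^sup>2 = 2 * c - c\<^sup>2"
    by blast+
  have "(norm (e - (c * r) *\<^sub>R a))\<^sup>2 = (norm e)\<^sup>2 - 2 * c * (r * (a \<bullet> e)) + c\<^sup>2 * r\<^sup>2 * (norm a)\<^sup>2"
    unfolding power2_norm_eq_inner
    by (simp add: inner_diff_left inner_diff_right inner_commute power2_eq_square algebra_simps)
  also have "\<dots> = (norm e)\<^sup>2 - 2 * c * (r * (a \<bullet> e)) + c\<^sup>2 * r\<^sup>2"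
    by (simp add: unit)
  also have "\<dots> \<le> (norm e)\<^sup>2 - (2 * c - c\<^sup>2) * r\<^sup>2"
    using mult_left_mono[OF r, of "2 * c"] c(2) by (simp add: algebra_simps)
  finally show ?thesis
    by (simp only: c)
qed

lemma averaged_decrease:
  fixes r :: "real^'m" and v :: "'m \<Rightarrow> real"
  assumes decrease: "\<And>i. v i \<le> d - \<gamma> * (r $ i)\<^sup>2" and "\<gamma> \<ge> 0" and error_bound: "\<sigma> * d \<le> (norm r)\<^sup>2"
  shows "(\<Sum>i\<in>UNIV. 1 / real CARD('m) * v i) \<le> (1 - \<gamma> * (\<sigma> / real CARD('m))) * d"
proof -
  have "(\<Sum>i\<in>UNIV. v i) \<le> (\<Sum>i\<in>UNIV. d - \<gamma> * (r $ i)\<^sup>2)"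
    by (intro sum_mono decrease)
  also have "\<dots> = real CARD('m) * d - \<gamma> * (norm r)\<^sup>2"
    by (simp add: sum_subtractf sum_distrib_left norm_vec_def L2_set_def real_sqrt_pow2 sum_nonneg)
  also have "\<dots> \<le> real CARD('m) * d - \<gamma> * (\<sigma> * d)"
    using mult_left_mono[OF error_bound \<open>\<gamma> \<ge> 0\<close>] by simp
  finally have "1 / real CARD('m) * (\<Sum>i\<in>UNIV. v i) \<le> 1 / real CARD('m) * (real CARD('m) * d - \<gamma> * (\<sigma> * d))"
    by (intro mult_left_mono) auto
  also have "\<dots> = (1 - \<gamma> * (\<sigma> / real CARD('m))) * d"
    by (simp add: field_simps)
  finally show ?thesis
    by (simp add: sum_distrib_left)
qed

lemma norm_matrix_unit_rows:
  fixes A :: "real^'n^'m"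
  assumes "\<And>i. (norm (row i A))\<^sup>2 = 1"
  shows "(norm A)\<^sup>2 = real CARD('m)"
proof -
  have "(norm A)\<^sup>2 = (\<Sum>i\<in>UNIV. (norm (row i A))\<^sup>2)"
    by (simp add: norm_matrix_frobenius row_def norm_vec_def L2_set_def real_sqrt_pow2 sum_nonneg)
  then show ?thesis by (simp add: assms)
qed

definition rpk_step :: "(real \<Rightarrow> real) \<Rightarrow> real \<Rightarrow> real^'n^'m \<Rightarrow> real^'m \<Rightarrow> 'm \<Rightarrow> real^'n \<Rightarrow> real^'n" where
  "rpk_step \<phi> \<rho> A b i x =
     x - (\<phi> (row i A \<bullet> x - b $ i) / (1 / \<rho> + (norm (row i A))\<^sup>2)) *\<^sub>R row i A"

lemma rpk_Suc: "rpk \<phi> \<rho> A b x0 s (Suc k) = rpk_step \<phi> \<rho> A b (s k) (rpk \<phi> \<rho> A b x0 s k)"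
  by (simp add: rpk_step_def Let_def)

text \<open>
  Here \<open>f\<close> is the squared error, \<open>r\<close> the vector of residuals as the iteration sees them, and
  \<open>\<sigma>\<close> the constant of the error bound; the rate depends on the problem only through \<open>\<sigma>\<close>.
\<close>

lemma rpk_expected_contraction:
  fixes A :: "real^'n^'m" and M :: "'w measure" and f :: "real^'n \<Rightarrow> real" and r :: "real^'n \<Rightarrow> real^'m"
  assumes unit_rows: "\<And>i. (norm (row i A))\<^sup>2 = 1" and selection: "random_row_selection A M idx"
    and inv_start: "I x0" and inv_step: "\<And>i x. I x \<Longrightarrow> I (rpk_step \<phi> \<rho> A b i x)"
    and \<gamma>: "\<gamma> \<ge> 0"
    and decrease: "\<And>i x. I x \<Longrightarrow> f (rpk_step \<phi> \<rho> A b i x) \<le> f x - \<gamma> * (r x $ i)\<^sup>2"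
    and error_bound: "\<And>x. I x \<Longrightarrow> \<sigma> * f x \<le> (norm (r x))\<^sup>2"
  shows "(\<integral>\<omega>. f (rpk \<phi> \<rho> A b x0 (\<lambda>j. idx j \<omega>) (Suc k)) \<partial>M) \<le>
    (1 - \<gamma> * (\<sigma> / real CARD('m))) * (\<integral>\<omega>. f (rpk \<phi> \<rho> A b x0 (\<lambda>j. idx j \<omega>) k) \<partial>M)"
proof -
  interpret prob_space M
    using selection by (simp add: random_row_selection_def)
  have indep: "indep_vars (\<lambda>_. count_space UNIV) idx UNIV"
    and prob: "\<And>k i. prob {\<omega> \<in> space M. idx k \<omega> = i} = 1 / real CARD('m)"
    using selection by (simp_all add: random_row_selection_def unit_rows norm_matrix_unit_rows)
  show ?thesis
  proof (rule expected_contraction[OF indep, where I = I and ?x0.0 = x0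
        and T = "rpk_step \<phi> \<rho> A b"])
    show "(\<Sum>i\<in>UNIV. prob {\<omega> \<in> space M. idx k \<omega> = i} * f (rpk_step \<phi> \<rho> A b i x)) \<le>
        (1 - \<gamma> * (\<sigma> / real CARD('m))) * f x" if "I x" for k x
      unfolding prob using decrease[OF that] \<gamma> error_bound[OF that] by (rule averaged_decrease)
  qed (simp_all add: rpk_Suc inv_start inv_step del: rpk.simps(2))
qed

section \<open>Convergence of the penalty Kaczmarz iteration\<close>

theorem theorem2:
  fixes A :: "real^'n^'m" and b :: "real^'m" and x0 :: "real^'n" and \<rho> :: real
    and M :: "'w measure" and idx :: "nat \<Rightarrow> 'w \<Rightarrow> 'm"
  assumes unit_rows: "\<And>i. (norm (row i A))\<^sup>2 = 1"
    and rho_pos: "\<rho> > 0"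
    and selection: "random_row_selection A M idx"
  shows "((\<exists>x. A *v x = b) \<longrightarrow>
      (\<exists>xs. is_arg_min (\<lambda>x. (norm (x0 - x))\<^sup>2) (\<lambda>x. A *v x = b) xs) \<and>
      (\<forall>xs. is_arg_min (\<lambda>x. (norm (x0 - x))\<^sup>2) (\<lambda>x. A *v x = b) xs \<longrightarrow>
        xs = x0 - pinv A *v (A *v x0 - b) \<and>
        (\<lambda>k. \<integral>\<omega>. (norm (rpk_LS \<rho> A b x0 (\<lambda>j. idx j \<omega>) k - xs))\<^sup>2 \<partial>M) \<longlonglongrightarrow> 0 \<and>
        (\<forall>k. (\<integral>\<omega>. (norm (rpk_LS \<rho> A b x0 (\<lambda>j. idx j \<omega>) (k + 1) - xs))\<^sup>2 \<partial>M)
             \<le> (1 - \<rho> * (\<rho> + 2) / (1 + \<rho>)\<^sup>2 * (lambda_min (transpose A ** A) / real CARD('m))) ^ (k + 1)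
               * (\<integral>\<omega>. (norm (rpk_LS \<rho> A b x0 (\<lambda>j. idx j \<omega>) 0 - xs))\<^sup>2 \<partial>M)))) \<and>
    (feasible_region A b \<noteq> {} \<longrightarrow>
      (\<forall>L. hoffman_constant A b L \<longrightarrow>
        (\<lambda>k. \<integral>\<omega>. (infdist (rpk_LF \<rho> A b x0 (\<lambda>j. idx j \<omega>) k) (feasible_region A b))\<^sup>2 \<partial>M) \<longlonglongrightarrow> 0 \<and>
        (\<forall>k. (\<integral>\<omega>. (infdist (rpk_LF \<rho> A b x0 (\<lambda>j. idx j \<omega>) (k + 1)) (feasible_region A b))\<^sup>2 \<partial>M)
             \<le> (1 - \<rho> * (\<rho> + 2) / (1 + \<rho>)\<^sup>2 * (1 / (real CARD('m) * L\<^sup>2))) ^ (k + 1)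
               * (\<integral>\<omega>. (infdist (rpk_LF \<rho> A b x0 (\<lambda>j. idx j \<omega>) 0) (feasible_region A b))\<^sup>2 \<partial>M))))"
proof -
  define \<gamma> where "\<gamma> = \<rho> * (\<rho> + 2) / (1 + \<rho>)\<^sup>2"
  have \<gamma>: "\<gamma> > 0" using rho_pos by (simp add: \<gamma>_def)
  have LS: "(\<lambda>k. \<integral>\<omega>. (norm (rpk_LS \<rho> A b x0 (\<lambda>j. idx j \<omega>) k - xs))\<^sup>2 \<partial>M) \<longlonglongrightarrow> 0 \<and>
      (\<forall>k. (\<integral>\<omega>. (norm (rpk_LS \<rho> A b x0 (\<lambda>j. idx j \<omega>) (k + 1) - xs))\<^sup>2 \<partial>M)
         \<le> (1 - \<gamma> * (lambda_min (transpose A ** A) / real CARD('m))) ^ (k + 1)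
           * (\<integral>\<omega>. (norm (rpk_LS \<rho> A b x0 (\<lambda>j. idx j \<omega>) 0 - xs))\<^sup>2 \<partial>M))"
    if xs: "A *v xs = b" "x0 - xs \<in> null_complement A" for xs
  proof -
    let ?u = "\<lambda>k. \<integral>\<omega>. (norm (rpk (\<lambda>t. t) \<rho> A b x0 (\<lambda>j. idx j \<omega>) k - xs))\<^sup>2 \<partial>M"
    let ?I = "\<lambda>x. x - xs \<in> null_complement A"
    have residual: "row i A \<bullet> x - b $ i = row i A \<bullet> (x - xs)" for i x
      using xs(1) by (simp add: inner_diff_right row_inner)
    have error_step: "rpk_step (\<lambda>t. t) \<rho> A b i x - xs =
        (x - xs) - (row i A \<bullet> (x - xs) / (1 / \<rho> + (norm (row i A))\<^sup>2)) *\<^sub>R row i A" for i x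
      by (simp add: rpk_step_def residual)
    \<comment> \<open>Used with two constants \<open>\<sigma>\<close>: a positive one for convergence, the smallest eigenvalue for the rate.\<close>
    have step: "?u (Suc k) \<le> (1 - \<gamma> * (\<sigma> / real CARD('m))) * ?u k"
      if "\<And>e. e \<in> null_complement A \<Longrightarrow> \<sigma> * (norm e)\<^sup>2 \<le> (norm (A *v e))\<^sup>2" for \<sigma> k
    proof (rule rpk_expected_contraction[OF unit_rows selection, where I = ?I and r = "\<lambda>x. A *v (x - xs)"])
      show "?I x0" by (rule xs(2))
      show "?I (rpk_step (\<lambda>t. t) \<rho> A b i x)" if "?I x" for i x
        unfolding error_step
        by (intro subspace_diff subspace_scale subspace_null_complement row_in_null_complement that)
      show "(norm (rpk_step (\<lambda>t. t) \<rho> A b i x - xs))\<^sup>2 \<le>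
          (norm (x - xs))\<^sup>2 - \<gamma> * ((A *v (x - xs)) $ i)\<^sup>2" for i x
        unfolding error_step \<gamma>_def row_inner[symmetric]
        by (rule damped_step_decrease[OF unit_rows rho_pos]) (simp add: power2_eq_square)
    qed (use \<gamma> that in auto)
    obtain \<sigma> where \<sigma>: "\<sigma> > 0"
        "\<And>e. e \<in> null_complement A \<Longrightarrow> \<sigma> * (norm e)\<^sup>2 \<le> (norm (A *v e))\<^sup>2"
      by (rule null_complement_bounded_below) blast
    have "?u \<longlonglongrightarrow> 0"
    proof (rule geometric_decay(2))
      show "?u (Suc k) \<le> (1 - \<gamma> * (\<sigma> / real CARD('m))) * ?u k" for k
        by (rule step) (rule \<sigma>(2))
    qed (use \<gamma> \<sigma>(1) in auto)
    moreover have "?u (k + 1) \<le> (1 - \<gamma> * (lambda_min (transpose A ** A) / real CARD('m))) ^ (k + 1) * ?u 0"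
      for k
    proof (rule geometric_decay(1))
      show "?u (Suc k) \<le> (1 - \<gamma> * (lambda_min (transpose A ** A) / real CARD('m))) * ?u k" for k
        by (rule step) (rule lambda_min_gram_le)
    qed simp
    ultimately show ?thesis
      unfolding rpk_LS_def by blast
  qed
  have LF: "(\<lambda>k. \<integral>\<omega>. (infdist (rpk_LF \<rho> A b x0 (\<lambda>j. idx j \<omega>) k) (feasible_region A b))\<^sup>2 \<partial>M) \<longlonglongrightarrow> 0 \<and>
      (\<forall>k. (\<integral>\<omega>. (infdist (rpk_LF \<rho> A b x0 (\<lambda>j. idx j \<omega>) (k + 1)) (feasible_region A b))\<^sup>2 \<partial>M)
         \<le> (1 - \<gamma> * (1 / (real CARD('m) * L\<^sup>2))) ^ (k + 1)
           * (\<integral>\<omega>. (infdist (rpk_LF \<rho> A b x0 (\<lambda>j. idx j \<omega>) 0) (feasible_region A b))\<^sup>2 \<partial>M))"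
    if ne: "feasible_region A b \<noteq> {}" and hoffman: "hoffman_constant A b L" for L
  proof -
    let ?X = "feasible_region A b"
    let ?\<phi> = "\<lambda>t :: real. max t 0"
    let ?u = "\<lambda>k. \<integral>\<omega>. (infdist (rpk ?\<phi> \<rho> A b x0 (\<lambda>j. idx j \<omega>) k) ?X)\<^sup>2 \<partial>M"
    have L: "L > 0" "\<And>x. (infdist x ?X)\<^sup>2 \<le> L\<^sup>2 * (norm (pos_part (A *v x - b)))\<^sup>2"
      using hoffman by (auto simp: hoffman_constant_def)
    have step: "?u (Suc k) \<le> (1 - \<gamma> * ((1 / L\<^sup>2) / real CARD('m))) * ?u k" for k
    proof (rule rpk_expected_contraction[OF unit_rows selection, where I = "\<lambda>_. True"
          and r = "\<lambda>x. pos_part (A *v x - b)"])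
      show "1 / L\<^sup>2 * (infdist x ?X)\<^sup>2 \<le> (norm (pos_part (A *v x - b)))\<^sup>2" for x
        using L by (simp add: field_simps)
      show "(infdist (rpk_step ?\<phi> \<rho> A b i x) ?X)\<^sup>2 \<le>
          (infdist x ?X)\<^sup>2 - \<gamma> * (pos_part (A *v x - b) $ i)\<^sup>2" for i x
      proof -
        define p where "p = closest_point ?X x"
        define t where "t = row i A \<bullet> x - b $ i"
        have p: "p \<in> ?X" "infdist x ?X = norm (x - p)"
          using infdist_feasible_region(1,2)[OF ne] by (auto simp: p_def)
        have "row i A \<bullet> p \<le> b $ i"
          using p(1) by (simp add: feasible_region_def less_eq_vec_def row_inner)
        then have t: "t \<le> row i A \<bullet> (x - p)"
          by (simp add: t_def inner_diff_right)
        have "infdist (rpk_step ?\<phi> \<rho> A b i x) ?X \<le> norm (rpk_step ?\<phi> \<rho> A b i x - p)"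
          by (rule infdist_feasible_region(3)[OF ne p(1)])
        then have "(infdist (rpk_step ?\<phi> \<rho> A b i x) ?X)\<^sup>2 \<le> (norm (rpk_step ?\<phi> \<rho> A b i x - p))\<^sup>2"
          by (intro power_mono infdist_nonneg)
        also have "rpk_step ?\<phi> \<rho> A b i x - p =
            (x - p) - (?\<phi> t / (1 / \<rho> + (norm (row i A))\<^sup>2)) *\<^sub>R row i A"
          by (simp add: rpk_step_def t_def)
        also have "(norm \<dots>)\<^sup>2 \<le> (norm (x - p))\<^sup>2 - \<gamma> * (?\<phi> t)\<^sup>2"
          unfolding \<gamma>_def
        proof (rule damped_step_decrease[OF unit_rows rho_pos])
          show "(?\<phi> t)\<^sup>2 \<le> ?\<phi> t * (row i A \<bullet> (x - p))"
            using t by (auto simp: max_def power2_eq_square intro: mult_left_mono)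
        qed
        also have "?\<phi> t = pos_part (A *v x - b) $ i"
          by (simp add: pos_part_def t_def row_inner)
        finally show ?thesis by (simp add: p(2))
      qed
    qed (use \<gamma> in auto)
    have "1 / L\<^sup>2 / real CARD('m) = 1 / (real CARD('m) * L\<^sup>2)"
      by simp
    note step' = step[unfolded this]
    have "?u \<longlonglongrightarrow> 0"
      by (rule geometric_decay(2)[where u = ?u, OF _ step']) (use \<gamma> L(1) in auto)
    moreover have "?u (k + 1) \<le> (1 - \<gamma> * (1 / (real CARD('m) * L\<^sup>2))) ^ (k + 1) * ?u 0" for k
      by (rule geometric_decay(1)[where u = ?u, OF _ step']) simp
    ultimately show ?thesis
      unfolding rpk_LF_def by blast
  qed
  have nearest: "A *v (x0 - pinv A *v (A *v x0 - b)) = b"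
      "x0 - (x0 - pinv A *v (A *v x0 - b)) \<in> null_complement A" if "\<exists>x. A *v x = b"
    using that pinv_correction by blast+
  show ?thesis
  proof (intro conjI impI, goal_cases)
    case 1
    then show ?case
      using is_arg_min_nearest_solution_iff[OF nearest] by blast
  next
    case 2
    show ?case
      unfolding is_arg_min_nearest_solution_iff[OF nearest[OF 2]]
      using LS[OF nearest[OF 2]] unfolding \<gamma>_def by blast
  next
    case 3
    then show ?case
      using LF unfolding \<gamma>_def by blast
  qed
qed

end
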